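(* Let $\Omega_{\mathrm{ph},0},\Omega_{\Lambda,0}$ be real constants and, for a real number $w$, consider the differential equation for a positive differentiable function $x(t)$: $$\left(\frac{\dot x}{x}\right)^2=\Omega_{\mathrm{ph},0}\,x^{-3(1+w)}+\Omega_{\Lambda,0}.\qquad(E_w)$$ This equation preserves its form under the transformation $x\mapsto 1/x$, $(1+w)\mapsto-(1+w)$. In particular, if $w>-1$ and $x(t)$ is a solution of $(E_w)$, corresponding to the sub-negative equation of state $p=w\rho$, then $x^{-1}(t)$ is a solution of $(E_{-(w+2)})$, corresponding to the equation of state $p=-(w+2)\rho$.
   Context: Equation $(E_w)$ is the first integral of the flat Friedmann–Robertson–Walker model filled with a cosmological constant and a fluid with barotropic equation of state $p=w\rho$, $w$ constant; here $x=a/a_0$ is the normalized scale factor, $\dot{\ }=d/dt$, and $\Omega_{\mathrm{ph},0},\Omega_{\Lambda,0}$ are the present-epoch density parameters of the fluid and of the cosmological constant. "Sub-negative" means $p>-\rho$, i.e. $w>-1$; phantom matter corresponds to $w<-1$. *)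

theory Defs
  imports "HOL-Analysis.Analysis"
begin

text \<open>
  Time domains are arbitrary intervals with more than one point.  Derivatives are taken within the
  domain, so they are one-sided at endpoints that belong to it and ordinary ones elsewhere.
\<close>

definition time_interval :: "real set \<Rightarrow> bool" where
  "time_interval T \<longleftrightarrow> is_interval T \<and> (\<exists>a\<in>T. \<exists>b\<in>T. a < b)"

definition positive_differentiable :: "real set \<Rightarrow> (real \<Rightarrow> real) \<Rightarrow> bool" where
  "positive_differentiable T x \<longleftrightarrow> (\<forall>t\<in>T. 0 < x t) \<and> x differentiable_on T"

text \<open>
  The equation \<open>(E_w)\<close> at time \<open>t\<close>.  The parameter \<open>w\<close> is that of the equation of state
  \<open>p = w * \<rho>\<close> of the fluid; \<open>\<Omega>ph\<close> and \<open>\<Omega>\<Lambda>\<close> are the present density parameters.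
\<close>

definition friedmann_eq ::
    "real \<Rightarrow> real \<Rightarrow> real \<Rightarrow> real set \<Rightarrow> (real \<Rightarrow> real) \<Rightarrow> real \<Rightarrow> bool" where
  "friedmann_eq \<Omega>ph \<Omega>\<Lambda> w T x t \<longleftrightarrow>
     (vector_derivative x (at t within T) / x t)\<^sup>2 = \<Omega>ph * x t powr (-3 * (1 + w)) + \<Omega>\<Lambda>"

definition friedmann_solution ::
    "real \<Rightarrow> real \<Rightarrow> real \<Rightarrow> real set \<Rightarrow> (real \<Rightarrow> real) \<Rightarrow> bool" where
  "friedmann_solution \<Omega>ph \<Omega>\<Lambda> w T x \<longleftrightarrow>
     positive_differentiable T x \<and> (\<forall>t\<in>T. friedmann_eq \<Omega>ph \<Omega>\<Lambda> w T x t)"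

end

theory Submission
  imports Defs
begin

text \<open>
  Passing from \<open>x\<close> to \<open>1 / x\<close> changes the sign of the logarithmic derivative, so the left-hand side
  of \<open>(E_w)\<close> is unchanged, while on the right-hand side \<open>(1 / x) powr p = x powr (- p)\<close>.
\<close>

text \<open>A connected set that is not a singleton has no isolated points. Limits within
  \<open>T\<close> are therefore unique at every \<open>t\<close> in \<open>T\<close>, endpoints
  included, so \<open>vector_derivative\<close> within \<open>T\<close> has at most one candidate
  value.\<close>

lemma time_interval_at_within_nontrivial:
  assumes "time_interval T" and "t \<in> T"
  shows "at t within T \<noteq> bot"
proof -
  obtain a b where "is_interval T" "a \<in> T" "b \<in> T" "a < b"
    using assms(1) by (auto simp: time_interval_def)
  then have "connected T" and "\<And>c. T \<noteq> {c}"
    using is_interval_connected by fastforce+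
  with \<open>t \<in> T\<close> show ?thesis
    by (simp add: connected_imp_perfect trivial_limit_within)
qed

lemma positive_differentiable_reciprocal:
  assumes "positive_differentiable T x"
  shows "positive_differentiable T (\<lambda>t. 1 / x t)"
  unfolding positive_differentiable_def differentiable_on_def
proof (intro conjI ballI)
  fix t assume "t \<in> T"
  with assms have "0 < x t" and "x differentiable (at t within T)"
    by (simp_all add: positive_differentiable_def differentiable_on_def)
  then show "0 < 1 / x t" and "(\<lambda>t. 1 / x t) differentiable (at t within T)"
    by (simp_all add: differentiable_divide)
qed

text \<open>The derivative of \<open>1 / x\<close> is \<open>- x' / x^2\<close>, and dividing by
  \<open>1 / x\<close> leaves \<open>- x' / x\<close>.\<close>

lemma log_derivative_reciprocal:
  fixes x :: "real \<Rightarrow> real"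
  assumes "at t within T \<noteq> bot" and "x differentiable (at t within T)" and "x t \<noteq> 0"
  shows "vector_derivative (\<lambda>t. 1 / x t) (at t within T) / (1 / x t)
           = - (vector_derivative x (at t within T) / x t)"
proof -
  let ?d = "vector_derivative x (at t within T)"
  have "(x has_real_derivative ?d) (at t within T)"
    using assms(2)
    by (simp add: has_real_derivative_iff_has_vector_derivative vector_derivative_works)
  from DERIV_inverse'[OF this \<open>x t \<noteq> 0\<close>]
  have "((\<lambda>t. 1 / x t) has_vector_derivative - (inverse (x t) * ?d * inverse (x t))) (at t within T)"
    by (simp add: has_real_derivative_iff_has_vector_derivative inverse_eq_divide)
  \<comment> \<open>\<open>vector_derivative\<close> is a choice among all derivatives at the
    filter; nontriviality of the filter makes the derivative just computed the chosen one.\<close>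
  then have "vector_derivative (\<lambda>t. 1 / x t) (at t within T)
               = - (inverse (x t) * ?d * inverse (x t))"
    using assms(1) by (rule vector_derivative_within[rotated])
  with \<open>x t \<noteq> 0\<close> show ?thesis
    by (simp add: field_simps)
qed

text \<open>Each side of the transformed equation equals the corresponding side of the original one,
  which gives an equivalence at each time and not just an implication. The relation between
  \<open>w\<close> and \<open>w'\<close> is kept in the form in which it flips the exponent.\<close>

lemma friedmann_eq_reciprocal_iff:
  assumes "time_interval T" and "positive_differentiable T x" and "t \<in> T"
    and "1 + w' = - (1 + w)"
  shows "friedmann_eq \<Omega>ph \<Omega>\<Lambda> w' T (\<lambda>t. 1 / x t) t \<longleftrightarrow> friedmann_eq \<Omega>ph \<Omega>\<Lambda> w T x t"
proof -
  have pos: "x t > 0" and diff: "x differentiable (at t within T)"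
    using assms(2,3) by (auto simp: positive_differentiable_def differentiable_on_def)
  \<comment> \<open>Positivity of \<open>x t\<close> lets the real power distribute over the
    quotient \<open>1 / x t\<close>.\<close>
  have "(1 / x t) powr (-3 * (1 + w')) = x t powr (- (-3 * (1 + w')))"
    using pos by (simp add: powr_divide powr_minus_divide[symmetric])
  also have "- (-3 * (1 + w')) = -3 * (1 + w)"
    using assms(4) by simp
  finally have "(1 / x t) powr (-3 * (1 + w')) = x t powr (-3 * (1 + w))" .
  moreover have "vector_derivative (\<lambda>t. 1 / x t) (at t within T) / (1 / x t)
                   = - (vector_derivative x (at t within T) / x t)"
    using pos
    by (intro log_derivative_reciprocal time_interval_at_within_nontrivial assms diff) simp
  ultimately show ?thesis
    unfolding friedmann_eq_def by (simp only: power2_minus)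
qed

theorem mainTheorem3:
  fixes \<Omega>ph \<Omega>\<Lambda> :: real and T :: "real set"
  assumes "time_interval T"
  shows "(\<forall>(w::real) (w'::real) (x::real \<Rightarrow> real).
            1 + w' = - (1 + w) \<longrightarrow> positive_differentiable T x \<longrightarrow>
              positive_differentiable T (\<lambda>t. 1 / x t) \<and>
              (\<forall>t\<in>T. friedmann_eq \<Omega>ph \<Omega>\<Lambda> w' T (\<lambda>t. 1 / x t) t
                       \<longleftrightarrow> friedmann_eq \<Omega>ph \<Omega>\<Lambda> w T x t))
       \<and> (\<forall>(w::real) (x::real \<Rightarrow> real).
            w > -1 \<longrightarrow> friedmann_solution \<Omega>ph \<Omega>\<Lambda> w T x \<longrightarrow>
              friedmann_solution \<Omega>ph \<Omega>\<Lambda> (- (w + 2)) T (\<lambda>t. 1 / x t))"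
proof (intro conjI allI impI ballI)
  fix w w' :: real and x :: "real \<Rightarrow> real"
  assume w: "1 + w' = - (1 + w)" and x: "positive_differentiable T x"
  show "positive_differentiable T (\<lambda>t. 1 / x t)"
    using x by (rule positive_differentiable_reciprocal)
  fix t assume "t \<in> T"
  with assms x show "friedmann_eq \<Omega>ph \<Omega>\<Lambda> w' T (\<lambda>t. 1 / x t) t \<longleftrightarrow> friedmann_eq \<Omega>ph \<Omega>\<Lambda> w T x t"
    using w by (rule friedmann_eq_reciprocal_iff)
next
  fix w :: real and x :: "real \<Rightarrow> real"
  assume "friedmann_solution \<Omega>ph \<Omega>\<Lambda> w T x"
  then have x: "positive_differentiable T x" and eq: "\<And>t. t \<in> T \<Longrightarrow> friedmann_eq \<Omega>ph \<Omega>\<Lambda> w T x t"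
    by (simp_all add: friedmann_solution_def)
  \<comment> \<open>The value \<open>- (w + 2)\<close> is the solution \<open>w'\<close> of
    \<open>1 + w' = - (1 + w)\<close>, so the claim about solutions is an instance of the pointwise
    equivalence.\<close>
  have w: "1 + - (w + 2) = - (1 + w)"
    by simp
  show "friedmann_solution \<Omega>ph \<Omega>\<Lambda> (- (w + 2)) T (\<lambda>t. 1 / x t)"
    unfolding friedmann_solution_def
  proof (intro conjI ballI)
    show "positive_differentiable T (\<lambda>t. 1 / x t)"
      using x by (rule positive_differentiable_reciprocal)
    fix t assume "t \<in> T"
    then show "friedmann_eq \<Omega>ph \<Omega>\<Lambda> (- (w + 2)) T (\<lambda>t. 1 / x t) t"
      using friedmann_eq_reciprocal_iff[OF assms x _ w] eq by simp
  qed
qed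

end
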